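(* Let $G$ be an almost linear minimal group, with a definable strict partial order $<$ such that incomparability $\sim$ is an equivalence relation on $G$ and $G/{\sim}$, with the order induced by $<$, has order type $\omega$. Then, after modifying the order $<$ on a finite set, the map $v:G\to G/{\sim}$, $g\mapsto g/{\sim}$, endows $G$ with the structure of a valued abelian group, where $G/{\sim}$ is ordered by $g/{\sim}>g'/{\sim}$ if $g<g'$, and this order on $G/{\sim}$ is of order type $\omega^*$. In particular, $G$ as an almost linear group and $G$ as a valued group are interdefinable (with parameters).
   Context: An infinite first-order structure $M$ is minimal if every subset of $M$ definable with parameters is finite or co-finite. A minimal group is a minimal structure which is a group, possibly with additional first-order structure; minimal groups are abelian and written additively. The generic type of $M$ is the unique non-algebraic type $p\in S_1(M)$; $\bar M\succ M$ is a monster model. For a strict partial order $<$, put $x\sim y$ iff $\neg(x<y\vee y<x)$ (incomparability). A strict partial order $<$ on $M$, definable with parameters and with infinite chains, is almost linear if $\sim$ is an equivalence relation on the set $p(\bar M)$ of realizations of $p$; $M$ is almost linear if such an order exists. In an almost linear minimal group a definable order $<$ can always be chosen so that $\sim$ is an equivalence relation on $G$ and $G/{\sim}$ has order type $\omega$; such a choice is fixed. "Modifying $<$ on a finite set" means replacing $<$ by a definable strict partial order which agrees with $<$ on the complement of some finite set $F\subseteq G$ (relations between elements of $F$ and arbitrary elements may change); after the modification, $\sim$ denotes incomparability for the new order (which is again an equivalence relation). A valued abelian group is an abelian group $G$ with a surjective map $v:G\to\Gamma$, where $\Gamma$ is a linearly ordered set with maximum $\infty$, such that $v(x)=\infty$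 iff $x=0$, and $v(x-y)\ge\min\{v(x),v(y)\}$. $\omega^*$ is the reverse order of $\omega$. "Interdefinable" means that the order $<$ is definable with parameters in the valued group $(G,+,v)$, and the valuation (i.e. the relation $v(x)\le v(y)$) is definable with parameters in $(G,+,<)$. *)

theory Defs
  imports Main
begin

unbundle cardinal_syntax

section \<open>First-order logic\<close>

text \<open>A language assigns arities to the symbols belonging to it; a symbol mapped to
  \<^const>\<open>None\<close> is not in the language. The universe of a structure is its whole carrier
  type, and the values of an interpretation on lists whose length is not the arity are
  irrelevant, because well-formed formulas do not mention them.\<close>

record ('f, 'r) lang =
  fun_ar :: "'f \<Rightarrow> nat option"
  rel_ar :: "'r \<Rightarrow> nat option"

record ('f, 'r, 'a) struct =
  fun_int :: "'f \<Rightarrow> 'a list \<Rightarrow> 'a"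
  rel_int :: "'r \<Rightarrow> 'a list \<Rightarrow> bool"

datatype 'f trm = Var nat | App 'f "'f trm list"

datatype ('f, 'r) fm =
    Eq "'f trm" "'f trm"
  | Rel 'r "'f trm list"
  | Neg "('f, 'r) fm"
  | Conj "('f, 'r) fm" "('f, 'r) fm"
  | All nat "('f, 'r) fm"

primrec wf_trm :: "('f, 'r) lang \<Rightarrow> 'f trm \<Rightarrow> bool" where
  "wf_trm L (Var n) \<longleftrightarrow> True"
| "wf_trm L (App f ts) \<longleftrightarrow> fun_ar L f = Some (length ts) \<and> list_all (wf_trm L) ts"

primrec wf_fm :: "('f, 'r) lang \<Rightarrow> ('f, 'r) fm \<Rightarrow> bool" where
  "wf_fm L (Eq s t) \<longleftrightarrow> wf_trm L s \<and> wf_trm L t"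
| "wf_fm L (Rel R ts) \<longleftrightarrow> rel_ar L R = Some (length ts) \<and> list_all (wf_trm L) ts"
| "wf_fm L (Neg \<phi>) \<longleftrightarrow> wf_fm L \<phi>"
| "wf_fm L (Conj \<phi> \<psi>) \<longleftrightarrow> wf_fm L \<phi> \<and> wf_fm L \<psi>"
| "wf_fm L (All n \<phi>) \<longleftrightarrow> wf_fm L \<phi>"

primrec eval_trm :: "('f, 'r, 'a) struct \<Rightarrow> (nat \<Rightarrow> 'a) \<Rightarrow> 'f trm \<Rightarrow> 'a" where
  "eval_trm M e (Var n) = e n"
| "eval_trm M e (App f ts) = fun_int M f (map (eval_trm M e) ts)"

primrec sat :: "('f, 'r, 'a) struct \<Rightarrow> (nat \<Rightarrow> 'a) \<Rightarrow> ('f, 'r) fm \<Rightarrow> bool" where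
  "sat M e (Eq s t) \<longleftrightarrow> eval_trm M e s = eval_trm M e t"
| "sat M e (Rel R ts) \<longleftrightarrow> rel_int M R (map (eval_trm M e) ts)"
| "sat M e (Neg \<phi>) \<longleftrightarrow> \<not> sat M e \<phi>"
| "sat M e (Conj \<phi> \<psi>) \<longleftrightarrow> sat M e \<phi> \<and> sat M e \<psi>"
| "sat M e (All n \<phi>) \<longleftrightarrow> (\<forall>x. sat M (e(n := x)) \<phi>)"

text \<open>A formula with parameters in one (two) free variables is a pair of a formula and an
  assignment: variable \<open>0\<close> (variables \<open>0\<close> and \<open>1\<close>) are the free ones, and the values which the
  assignment gives to the other variables are the parameters.\<close>

definition set_of_fm :: "('f, 'r, 'a) struct \<Rightarrow> ('f, 'r) fm \<Rightarrow> (nat \<Rightarrow> 'a) \<Rightarrow> 'a set" where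
  "set_of_fm M \<phi> e = {x. sat M (e(0 := x)) \<phi>}"

definition rel_of_fm :: "('f, 'r, 'a) struct \<Rightarrow> ('f, 'r) fm \<Rightarrow> (nat \<Rightarrow> 'a) \<Rightarrow> 'a \<Rightarrow> 'a \<Rightarrow> bool" where
  "rel_of_fm M \<phi> e x y \<longleftrightarrow> sat M (e(0 := x, 1 := y)) \<phi>"

definition definable_set :: "('f, 'r) lang \<Rightarrow> ('f, 'r, 'a) struct \<Rightarrow> 'a set \<Rightarrow> bool" where
  "definable_set L M A \<longleftrightarrow> (\<exists>\<phi> e. wf_fm L \<phi> \<and> A = set_of_fm M \<phi> e)"

definition definable_rel :: "('f, 'r) lang \<Rightarrow> ('f, 'r, 'a) struct \<Rightarrow> ('a \<Rightarrow> 'a \<Rightarrow> bool) \<Rightarrow> bool" where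
  "definable_rel L M R \<longleftrightarrow> (\<exists>\<phi> e. wf_fm L \<phi> \<and> R = rel_of_fm M \<phi> e)"


section \<open>Minimal structures and minimal groups\<close>

definition minimal_structure :: "('f, 'r) lang \<Rightarrow> ('f, 'r, 'a) struct \<Rightarrow> bool" where
  "minimal_structure L M \<longleftrightarrow> infinite (UNIV :: 'a set) \<and>
     (\<forall>A. definable_set L M A \<longrightarrow> finite A \<or> finite (- A))"

text \<open>\<^class>\<open>group_add\<close> is the class of additively written, not necessarily commutative groups;
  \<open>pl\<close> is the symbol of the language which denotes the group operation.\<close>

definition minimal_group :: "('f, 'r) lang \<Rightarrow> ('f, 'r, 'a::group_add) struct \<Rightarrow> 'f \<Rightarrow> bool" where
  "minimal_group L M pl \<longleftrightarrow> minimal_structure L M \<and>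
     fun_ar L pl = Some 2 \<and> (\<forall>x y. fun_int M pl [x, y] = x + y)"


section \<open>The generic type and the monster model\<close>

definition complete_type :: "('f, 'r) lang \<Rightarrow> ('f, 'r, 'a) struct \<Rightarrow> (('f, 'r) fm \<times> (nat \<Rightarrow> 'a)) set \<Rightarrow> bool" where
  "complete_type L M p \<longleftrightarrow>
     (\<forall>(\<phi>, e) \<in> p. wf_fm L \<phi>) \<and>
     (\<forall>q. finite q \<and> q \<subseteq> p \<longrightarrow> (\<exists>x. \<forall>(\<phi>, e) \<in> q. x \<in> set_of_fm M \<phi> e)) \<and>
     (\<forall>\<phi> e. wf_fm L \<phi> \<longrightarrow> (\<phi>, e) \<in> p \<or> (Neg \<phi>, e) \<in> p)"

definition nonalgebraic :: "('f, 'r, 'a) struct \<Rightarrow> (('f, 'r) fm \<times> (nat \<Rightarrow> 'a)) set \<Rightarrow> bool" where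
  "nonalgebraic M p \<longleftrightarrow> (\<forall>(\<phi>, e) \<in> p. infinite (set_of_fm M \<phi> e))"

definition generic_type :: "('f, 'r) lang \<Rightarrow> ('f, 'r, 'a) struct \<Rightarrow> (('f, 'r) fm \<times> (nat \<Rightarrow> 'a)) set" where
  "generic_type L M = (THE p. complete_type L M p \<and> nonalgebraic M p)"

text \<open>Elementary extensions \<open>N\<close> of \<open>M\<close> are given by an elementary embedding \<open>h\<close>, along which
  parameters from \<open>M\<close> are moved to \<open>N\<close>.\<close>

definition elementary_embedding ::
  "('f, 'r) lang \<Rightarrow> ('f, 'r, 'a) struct \<Rightarrow> ('f, 'r, 'b) struct \<Rightarrow> ('a \<Rightarrow> 'b) \<Rightarrow> bool" where
  "elementary_embedding L M N h \<longleftrightarrow> (\<forall>\<phi> e. wf_fm L \<phi> \<longrightarrow> (sat M e \<phi> \<longleftrightarrow> sat N (h \<circ> e) \<phi>))"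

definition realizations ::
  "('f, 'r, 'b) struct \<Rightarrow> ('a \<Rightarrow> 'b) \<Rightarrow> (('f, 'r) fm \<times> (nat \<Rightarrow> 'a)) set \<Rightarrow> 'b set" where
  "realizations N h p = {b. \<forall>(\<phi>, e) \<in> p. b \<in> set_of_fm N \<phi> (h \<circ> e)}"

definition automorphism :: "('f, 'r) lang \<Rightarrow> ('f, 'r, 'b) struct \<Rightarrow> ('b \<Rightarrow> 'b) \<Rightarrow> bool" where
  "automorphism L N \<sigma> \<longleftrightarrow> bij \<sigma> \<and>
     (\<forall>f xs. fun_ar L f = Some (length xs) \<longrightarrow> \<sigma> (fun_int N f xs) = fun_int N f (map \<sigma> xs)) \<and>
     (\<forall>R xs. rel_ar L R = Some (length xs) \<longrightarrow> (rel_int N R xs \<longleftrightarrow> rel_int N R (map \<sigma> xs)))"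

text \<open>A monster model of \<open>M\<close> is an elementary extension which is \<open>\<kappa>\<close>-saturated and strongly
  \<open>\<kappa>\<close>-homogeneous for some \<open>\<kappa> > \<bar>M\<bar> + \<bar>L\<bar> + \<aleph>\<^sub>0\<close>. It suffices to ask this for the least such
  \<open>\<kappa>\<close>, so the small subsets are those of cardinality at most \<open>\<bar>M\<bar> + \<bar>L\<bar> + \<aleph>\<^sub>0\<close>. (The set of all
  formulas has cardinality \<open>\<bar>L\<bar> + \<aleph>\<^sub>0\<close>.)\<close>

definition small_subset :: "('f, 'r) lang \<Rightarrow> ('f, 'r, 'a) struct \<Rightarrow> 'b set \<Rightarrow> bool" where
  "small_subset L M A \<longleftrightarrow>
     |A| \<le>o |(UNIV :: 'a set) <+> {\<phi> :: ('f, 'r) fm. wf_fm L \<phi>}|"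

definition monster_model ::
  "('f, 'r) lang \<Rightarrow> ('f, 'r, 'a) struct \<Rightarrow> ('f, 'r, 'b) struct \<Rightarrow> ('a \<Rightarrow> 'b) \<Rightarrow> bool" where
  "monster_model L M N h \<longleftrightarrow>
     elementary_embedding L M N h \<and>
     (\<forall>A p. small_subset L M A \<and> (\<forall>(\<phi>, e) \<in> p. wf_fm L \<phi> \<and> range e \<subseteq> A) \<and>
        (\<forall>q. finite q \<and> q \<subseteq> p \<longrightarrow> (\<exists>b. \<forall>(\<phi>, e) \<in> q. b \<in> set_of_fm N \<phi> e)) \<longrightarrow>
        (\<exists>b. \<forall>(\<phi>, e) \<in> p. b \<in> set_of_fm N \<phi> e)) \<and>
     (\<forall>A g. small_subset L M A \<and>
        (\<forall>\<phi> e. wf_fm L \<phi> \<and> range e \<subseteq> A \<longrightarrow> (sat N e \<phi> \<longleftrightarrow> sat N (g \<circ> e) \<phi>)) \<longrightarrow>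
        (\<exists>\<sigma>. automorphism L N \<sigma> \<and> (\<forall>a\<in>A. \<sigma> a = g a)))"


section \<open>Almost linear structures\<close>

definition strict_partial_order :: "('a \<Rightarrow> 'a \<Rightarrow> bool) \<Rightarrow> bool" where
  "strict_partial_order lt \<longleftrightarrow> irreflp lt \<and> transp lt"

definition incomparability :: "'a set \<Rightarrow> ('a \<Rightarrow> 'a \<Rightarrow> bool) \<Rightarrow> 'a rel" where
  "incomparability A lt = {(x, y). x \<in> A \<and> y \<in> A \<and> \<not> (lt x y \<or> lt y x)}"

text \<open>The order defined in \<open>M\<close> by a formula with parameters is extended to \<open>N\<close> by evaluating
  the same formula there.\<close>

definition almost_linear ::
  "('f, 'r) lang \<Rightarrow> ('f, 'r, 'a) struct \<Rightarrow> ('f, 'r, 'b) struct \<Rightarrow> ('a \<Rightarrow> 'b) \<Rightarrow> bool" where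
  "almost_linear L M N h \<longleftrightarrow> (\<exists>\<phi> e. wf_fm L \<phi> \<and>
     strict_partial_order (rel_of_fm M \<phi> e) \<and>
     (\<exists>C. infinite C \<and> totalp_on C (rel_of_fm M \<phi> e)) \<and>
     (let P = realizations N h (generic_type L M)
      in equiv P (incomparability P (rel_of_fm N \<phi> (h \<circ> e)))))"


section \<open>The quotient by incomparability\<close>

abbreviation incomp :: "('a \<Rightarrow> 'a \<Rightarrow> bool) \<Rightarrow> 'a rel" where
  "incomp lt \<equiv> incomparability UNIV lt"

definition incomp_class :: "('a \<Rightarrow> 'a \<Rightarrow> bool) \<Rightarrow> 'a \<Rightarrow> 'a set" where
  "incomp_class lt x = incomp lt `` {x}"

definition quot_order :: "('a \<Rightarrow> 'a \<Rightarrow> bool) \<Rightarrow> 'a set rel" where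
  "quot_order lt = {(X, Y). X \<in> UNIV // incomp lt \<and> Y \<in> UNIV // incomp lt \<and>
     (X = Y \<or> (\<exists>x\<in>X. \<exists>y\<in>Y. lt x y))}"

text \<open>Orders are given by their reflexive relations \<open>\<le>\<close>.\<close>

definition order_type_omega :: "'g rel \<Rightarrow> bool" where
  "order_type_omega r \<longleftrightarrow> r =o natLeq"

definition order_type_omega_star :: "'g rel \<Rightarrow> bool" where
  "order_type_omega_star r \<longleftrightarrow> order_type_omega (r\<inverse>)"

text \<open>The order on the quotient used for the valuation is the reverse of the induced one.\<close>

definition value_order :: "('a \<Rightarrow> 'a \<Rightarrow> bool) \<Rightarrow> 'a set rel" where
  "value_order lt = (quot_order lt)\<inverse>"


section \<open>Valued abelian groups\<close>

definition min_wrt :: "'g rel \<Rightarrow> 'g \<Rightarrow> 'g \<Rightarrow> 'g" where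
  "min_wrt r a b = (if (a, b) \<in> r then a else b)"

definition valued_abelian_group :: "('a::group_add \<Rightarrow> 'g) \<Rightarrow> 'g set \<Rightarrow> 'g rel \<Rightarrow> bool" where
  "valued_abelian_group v \<Gamma> r \<longleftrightarrow>
     (\<forall>x y :: 'a. x + y = y + x) \<and>
     linear_order_on \<Gamma> r \<and>
     range v = \<Gamma> \<and>
     (\<exists>top\<in>\<Gamma>. (\<forall>\<gamma>\<in>\<Gamma>. (\<gamma>, top) \<in> r) \<and> (\<forall>x. v x = top \<longleftrightarrow> x = 0)) \<and>
     (\<forall>x y. (min_wrt r (v x) (v y), v (x - y)) \<in> r)"


section \<open>Modifications and interdefinability\<close>

definition finite_modification ::
  "('f, 'r) lang \<Rightarrow> ('f, 'r, 'a) struct \<Rightarrow> ('a \<Rightarrow> 'a \<Rightarrow> bool) \<Rightarrow> ('a \<Rightarrow> 'a \<Rightarrow> bool) \<Rightarrow> bool" where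
  "finite_modification L M lt lt' \<longleftrightarrow>
     definable_rel L M lt' \<and> strict_partial_order lt' \<and>
     (\<exists>F. finite F \<and> (\<forall>x y. x \<notin> F \<and> y \<notin> F \<longrightarrow> (lt' x y \<longleftrightarrow> lt x y)))"

text \<open>The structure \<open>(G, +, R)\<close> for a binary relation \<open>R\<close> on a group \<open>G\<close>.\<close>

definition group_rel_lang :: "(unit, unit) lang" where
  "group_rel_lang = \<lparr>fun_ar = (\<lambda>_. Some 2), rel_ar = (\<lambda>_. Some 2)\<rparr>"

definition group_rel_struct :: "('a::group_add \<Rightarrow> 'a \<Rightarrow> bool) \<Rightarrow> (unit, unit, 'a) struct" where
  "group_rel_struct R = \<lparr>fun_int = (\<lambda>_ xs. xs ! 0 + xs ! 1), rel_int = (\<lambda>_ xs. R (xs ! 0) (xs ! 1))\<rparr>"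

text \<open>The valued group is the structure \<open>(G, +, v)\<close>, where the valuation is given by the
  relation \<open>v x \<le> v y\<close> on \<open>G\<close>.\<close>

definition valuation_rel :: "('a \<Rightarrow> 'g) \<Rightarrow> 'g rel \<Rightarrow> 'a \<Rightarrow> 'a \<Rightarrow> bool" where
  "valuation_rel v r x y \<longleftrightarrow> (v x, v y) \<in> r"

definition interdefinable :: "('a::group_add \<Rightarrow> 'a \<Rightarrow> bool) \<Rightarrow> ('a \<Rightarrow> 'g) \<Rightarrow> 'g rel \<Rightarrow> bool" where
  "interdefinable lt v r \<longleftrightarrow>
     definable_rel group_rel_lang (group_rel_struct (valuation_rel v r)) lt \<and>
     definable_rel group_rel_lang (group_rel_struct lt) (valuation_rel v r)"

end

theory Submission
  imports Defs "HOL-Library.Infinite_Set"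
begin

text \<open>Let \<open>\<rho> : G \<rightarrow> \<omega>\<close> be the rank of the order. A translation \<open>x \<mapsto> x + a\<close> preserves the rank of
  all but finitely many \<open>x\<close>: by minimality it would otherwise increase or decrease almost all
  ranks, which is impossible since the sets \<open>{x. \<rho> x \<le> n}\<close> are finite. Hence the sets
  \<open>{a. \<forall>x. n < \<rho> x \<longrightarrow> \<rho> (x + a) = \<rho> x}\<close> are finite subgroups, increasing in \<open>n\<close>, with union \<open>G\<close>;
  together with \<open>{0}\<close> they are the balls of a definable valuation, with rank \<open>val\<close>. Finally,
  minimality forces \<open>\<rho>\<close> and \<open>val\<close> to order \<open>G\<close> in the same way up to finitely many elements: the
  \<open>a\<close> such that \<open>\<rho> b < \<rho> a\<close> implies \<open>val b < val a\<close> for all \<open>b\<close> form an infinite definable set,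
  and so do those for the converse implication.\<close>

section \<open>Reducts\<close>

abbreviation "Imp \<phi> \<psi> \<equiv> Neg (Conj \<phi> (Neg \<psi>))"
abbreviation "Exi n \<phi> \<equiv> Neg (All n (Neg \<phi>))"
abbreviation "Plus s t \<equiv> App () [s, t]"
abbreviation "Less s t \<equiv> Rel () [s, t]"

lemma group_rel_simps [simp]:
  "fun_ar group_rel_lang f = Some 2" "rel_ar group_rel_lang r = Some 2"
  "fun_int (group_rel_struct R) f xs = xs ! 0 + xs ! 1"
  "rel_int (group_rel_struct R) r xs = R (xs ! 0) (xs ! 1)"
  by (simp_all add: group_rel_lang_def group_rel_struct_def)

section \<open>Truth depends only on the variables that occur\<close>

primrec vars_trm :: "'f trm \<Rightarrow> nat set" where
  "vars_trm (Var n) = {n}"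
| "vars_trm (App f ts) = \<Union> (set (map vars_trm ts))"

text \<open>Bound variables are counted as well; this overestimate is harmless, since only
  finiteness and an upper bound enter.\<close>

primrec vars_fm :: "('f, 'r) fm \<Rightarrow> nat set" where
  "vars_fm (Eq s t) = vars_trm s \<union> vars_trm t"
| "vars_fm (Rel R ts) = \<Union> (set (map vars_trm ts))"
| "vars_fm (Neg \<phi>) = vars_fm \<phi>"
| "vars_fm (Conj \<phi> \<psi>) = vars_fm \<phi> \<union> vars_fm \<psi>"
| "vars_fm (All n \<phi>) = insert n (vars_fm \<phi>)"

lemma finite_vars_trm: "finite (vars_trm t)"
  by (induction t) auto

lemma finite_vars_fm: "finite (vars_fm \<phi>)"
  by (induction \<phi>) (auto simp: finite_vars_trm)

lemma eval_trm_cong: "(\<And>n. n \<in> vars_trm t \<Longrightarrow> d n = e n) \<Longrightarrow> eval_trm M d t = eval_trm M e t"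
proof (induction t)
  case (App f ts)
  have "eval_trm M d t = eval_trm M e t" if "t \<in> set ts" for t
    using that by (rule App.IH) (rule App.prems, use that in auto)
  then have "map (eval_trm M d) ts = map (eval_trm M e) ts"
    by simp
  then show ?case by (simp only: eval_trm.simps)
next
  case (Var n)
  from Var[of n] show ?case by simp
qed

lemma sat_cong: "(\<And>n. n \<in> vars_fm \<phi> \<Longrightarrow> d n = e n) \<Longrightarrow> sat M d \<phi> \<longleftrightarrow> sat M e \<phi>"
proof (induction \<phi> arbitrary: d e)
  case (Eq s t)
  have "eval_trm M d s = eval_trm M e s" "eval_trm M d t = eval_trm M e t"
    by (rule eval_trm_cong, rule Eq.prems, simp)+
  then show ?case by simp
next
  case (Rel R ts)
  have "eval_trm M d t = eval_trm M e t" if "t \<in> set ts" for t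
    by (rule eval_trm_cong) (rule Rel.prems, use that in auto)
  then have "map (eval_trm M d) ts = map (eval_trm M e) ts"
    by simp
  then show ?case by (simp only: sat.simps)
next
  case (Neg \<phi>)
  have "sat M d \<phi> \<longleftrightarrow> sat M e \<phi>"
    by (rule Neg.IH) (rule Neg.prems, simp)
  then show ?case by simp
next
  case (Conj \<phi> \<psi>)
  have "sat M d \<phi> \<longleftrightarrow> sat M e \<phi>"
    by (rule Conj.IH(1)) (rule Conj.prems, simp)
  moreover have "sat M d \<psi> \<longleftrightarrow> sat M e \<psi>"
    by (rule Conj.IH(2)) (rule Conj.prems, simp)
  ultimately show ?case by simp
next
  case (All k \<phi>)
  have "(d(k := x)) n = (e(k := x)) n" if "n \<in> vars_fm \<phi>" for x n
    using All.prems[of n] that by simp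
  then have "sat M (d(k := x)) \<phi> \<longleftrightarrow> sat M (e(k := x)) \<phi>" for x
    by (rule All.IH)
  then show ?case by simp
qed

text \<open>To translate a formula about \<open>(G, +, lt)\<close>, its variables are shifted beyond those of the
  formula \<open>\<phi>\<close> which defines \<open>lt\<close>. Then \<open>lt s t\<close> becomes
  \<open>\<forall>x\<^sub>0 x\<^sub>1. x\<^sub>0 = s \<longrightarrow> x\<^sub>1 = t \<longrightarrow> \<phi>\<close>, and no substitution is needed.\<close>

primrec shift_trm :: "nat \<Rightarrow> 'f \<Rightarrow> unit trm \<Rightarrow> 'f trm" where
  "shift_trm N pl (Var n) = Var (n + N)"
| "shift_trm N pl (App u ts) = App pl (map (shift_trm N pl) ts)"

primrec shift_fm :: "nat \<Rightarrow> 'f \<Rightarrow> ('f, 'r) fm \<Rightarrow> (unit, unit) fm \<Rightarrow> ('f, 'r) fm" where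
  "shift_fm N pl \<phi> (Eq s t) = Eq (shift_trm N pl s) (shift_trm N pl t)"
| "shift_fm N pl \<phi> (Rel R ts) =
     All 0 (All 1 (Imp (Eq (Var 0) (shift_trm N pl (ts ! 0)))
       (Imp (Eq (Var 1) (shift_trm N pl (ts ! 1))) \<phi>)))"
| "shift_fm N pl \<phi> (Neg \<psi>) = Neg (shift_fm N pl \<phi> \<psi>)"
| "shift_fm N pl \<phi> (Conj \<psi> \<chi>) = Conj (shift_fm N pl \<phi> \<psi>) (shift_fm N pl \<phi> \<chi>)"
| "shift_fm N pl \<phi> (All n \<psi>) = All (n + N) (shift_fm N pl \<phi> \<psi>)"

text \<open>One assignment serves both formulas: the slots below \<open>N\<close> belong to
  \<open>\<phi>\<close>, with 0 and 1 as scratch space for its two arguments, and those from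
  \<open>N\<close> on to the translated formula.\<close>

definition shift_env :: "nat \<Rightarrow> (nat \<Rightarrow> 'a) \<Rightarrow> 'a \<Rightarrow> 'a \<Rightarrow> (nat \<Rightarrow> 'a) \<Rightarrow> nat \<Rightarrow> 'a" where
  "shift_env N e u v s n =
     (if n = 0 then u else if n = 1 then v else if n < N then e n else s (n - N))"

lemma shift_env_upd:
  assumes "2 \<le> N"
  shows "(shift_env N e u v s)(0 := x) = shift_env N e x v s"
    and "(shift_env N e u v s)(Suc 0 := x) = shift_env N e u x s"
    and "(shift_env N e u v s)(n + N := x) = shift_env N e u v (s(n := x))"
  using assms by (auto simp: shift_env_def fun_eq_iff)

lemma wf_shift_trm: "wf_trm group_rel_lang t \<Longrightarrow> fun_ar L pl = Some 2 \<Longrightarrow> wf_trm L (shift_trm N pl t)"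
  by (induction t) (auto simp: list_all_iff)

lemma length_2D: "length xs = 2 \<Longrightarrow> \<exists>x y. xs = [x, y]"
  by (auto simp: numeral_2_eq_2 length_Suc_conv)

lemma wf_shift_fm:
  "wf_fm group_rel_lang \<psi> \<Longrightarrow> fun_ar L pl = Some 2 \<Longrightarrow> wf_fm L \<phi> \<Longrightarrow> wf_fm L (shift_fm N pl \<phi> \<psi>)"
  by (induction \<psi>) (auto simp: wf_shift_trm dest!: length_2D)

lemma eval_shift_trm:
  assumes "2 \<le> N" and "\<forall>x y. fun_int M pl [x, y] = x + y"
  shows "wf_trm group_rel_lang t \<Longrightarrow>
    eval_trm M (shift_env N e u v s) (shift_trm N pl t) = eval_trm (group_rel_struct R) s t"
proof (induction t)
  case (Var n)
  then show ?case using assms by (simp add: shift_env_def)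
next
  case (App f ts)
  then obtain t1 t2 where "ts = [t1, t2]" by (auto dest!: length_2D)
  with App assms show ?case by simp
qed

text \<open>\<open>u\<close> and \<open>v\<close> are arbitrary because the translation of an atom
  overwrites slots 0 and 1 before \<open>\<phi>\<close> is evaluated.\<close>

lemma sat_shift_fm:
  assumes N: "2 \<le> N" "\<forall>n \<in> vars_fm \<phi>. n < N" and pl: "\<forall>x y. fun_int M pl [x, y] = x + y"
  shows "wf_fm group_rel_lang \<psi> \<Longrightarrow>
    sat M (shift_env N e u v s) (shift_fm N pl \<phi> \<psi>) \<longleftrightarrow> sat (group_rel_struct (rel_of_fm M \<phi> e)) s \<psi>"
proof (induction \<psi> arbitrary: u v s)
  case (Eq t1 t2)
  then show ?case by (simp add: eval_shift_trm[OF N(1) pl, where R = "rel_of_fm M \<phi> e"])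
next
  case (Rel r ts)
  then obtain t1 t2 where ts: "ts = [t1, t2]" by (auto dest!: length_2D)
  have "sat M (shift_env N e x y s) \<phi> \<longleftrightarrow> rel_of_fm M \<phi> e x y" for x y
    unfolding rel_of_fm_def by (rule sat_cong) (use N in \<open>auto simp: shift_env_def\<close>)
  with Rel ts N show ?case
    by (simp add: shift_env_upd eval_shift_trm[OF N(1) pl, where R = "rel_of_fm M \<phi> e"])
      (simp add: shift_env_def)
next
  case (All n \<psi>)
  then show ?case using N by (simp add: shift_env_upd)
qed simp_all

text \<open>Transitivity of definability; it carries what is defined in \<open>(G, +, lt)\<close>
  back to the original structure.\<close>

lemma definable_rel_reduct:
  assumes "definable_rel L M lt" and "fun_ar L pl = Some 2" and "\<forall>x y. fun_int M pl [x, y] = x + y"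
    and "definable_rel group_rel_lang (group_rel_struct lt) R"
  shows "definable_rel L M R"
proof -
  obtain \<phi> e where \<phi>: "wf_fm L \<phi>" "lt = rel_of_fm M \<phi> e"
    using assms unfolding definable_rel_def by blast
  obtain \<psi> s where \<psi>: "wf_fm group_rel_lang \<psi>" "R = rel_of_fm (group_rel_struct lt) \<psi> s"
    using assms unfolding definable_rel_def by blast
  have "finite (insert 1 (vars_fm \<phi>))"
    by (simp add: finite_vars_fm)
  then obtain N where "\<forall>n \<in> insert 1 (vars_fm \<phi>). n < N"
    unfolding finite_nat_set_iff_bounded by blast
  then have N: "2 \<le> N" "\<forall>n \<in> vars_fm \<phi>. n < N" by auto
  \<comment> \<open>The arguments arrive in slots 0 and 1, which the translation overwrites, so they
    are first copied to \<open>N\<close> and \<open>1 + N\<close>, the shifted variables 0 and 1 of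
    \<open>\<psi>\<close>. The two entries \<open>s 0\<close> below are dummies.\<close>
  let ?\<chi> = "All (0 + N) (All (1 + N) (Imp (Eq (Var (0 + N)) (Var 0))
    (Imp (Eq (Var (1 + N)) (Var 1)) (shift_fm N pl \<phi> \<psi>))))"
  have "rel_of_fm M ?\<chi> (shift_env N e (s 0) (s 0) s) x y \<longleftrightarrow> R x y" for x y
  proof -
    have "rel_of_fm M ?\<chi> (shift_env N e (s 0) (s 0) s) x y \<longleftrightarrow>
      sat M (shift_env N e x y (s(0 := x, 1 := y))) (shift_fm N pl \<phi> \<psi>)"
      using N unfolding rel_of_fm_def sat.simps One_nat_def shift_env_upd[OF N(1)]
      by (auto simp: shift_env_def)
    then show ?thesis
      by (simp add: sat_shift_fm[OF N assms(3) \<psi>(1)] \<psi>(2) \<phi>(2) rel_of_fm_def)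
  qed
  then have "R = rel_of_fm M ?\<chi> (shift_env N e (s 0) (s 0) s)"
    by (simp add: fun_eq_iff)
  moreover have "wf_fm L ?\<chi>"
    using wf_shift_fm[OF \<psi>(1) assms(2) \<phi>(1)] by simp
  ultimately show ?thesis
    unfolding definable_rel_def by blast
qed

lemma definable_set_section:
  assumes "definable_rel L M R"
  shows "definable_set L M {x. R x c}"
proof -
  obtain \<phi> e where \<phi>: "wf_fm L \<phi>" "R = rel_of_fm M \<phi> e"
    using assms unfolding definable_rel_def by blast
  have "{x. R x c} = set_of_fm M \<phi> (e(1 := c))"
    by (auto simp: \<phi>(2) rel_of_fm_def set_of_fm_def fun_upd_twist)
  with \<phi>(1) show ?thesis
    unfolding definable_set_def by blast
qed

text \<open>Comes from the binary case: read with two free variables, a formula for \<open>A\<close>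
  defines a relation whose section at the parameter \<open>s 1\<close> is \<open>A\<close>.\<close>

lemma definable_set_reduct:
  assumes "definable_rel L M lt" and "fun_ar L pl = Some 2" and "\<forall>x y. fun_int M pl [x, y] = x + y"
    and "definable_set group_rel_lang (group_rel_struct lt) A"
  shows "definable_set L M A"
proof -
  obtain \<psi> s where \<psi>: "wf_fm group_rel_lang \<psi>" "A = set_of_fm (group_rel_struct lt) \<psi> s"
    using assms unfolding definable_set_def by blast
  have "definable_rel L M (rel_of_fm (group_rel_struct lt) \<psi> s)"
    by (rule definable_rel_reduct[OF assms(1-3)]) (use \<psi> in \<open>auto simp: definable_rel_def\<close>)
  from definable_set_section[OF this, of "s 1"] show ?thesis
    by (simp add: \<psi>(2) rel_of_fm_def set_of_fm_def fun_upd_idem)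
qed

lemma minimal_structure_reduct:
  assumes "minimal_group L M pl" and "definable_rel L M lt"
  shows "minimal_structure group_rel_lang (group_rel_struct lt)"
proof -
  have pl: "fun_ar L pl = Some 2" "\<forall>x y. fun_int M pl [x, y] = x + y" and "minimal_structure L M"
    using assms(1) by (auto simp: minimal_group_def)
  then show ?thesis
    using definable_set_reduct[OF assms(2) pl] by (simp add: minimal_structure_def)
qed


section \<open>Commutativity\<close>

text \<open>\<open>y + g = g + x\<close> says that \<open>g\<close> conjugates \<open>x\<close> to
  \<open>y\<close> without negation, for which the language of \<open>(G, +, R)\<close> has no
  symbol.\<close>

lemma (in group_add) conjugate_add:
  "y + g = g + x \<Longrightarrow> y' + g = g + x' \<Longrightarrow> (y + y') + g = g + (x + x')"
  by (metis add.assoc)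

text \<open>The iterated doubles of \<open>t\<close> stay in a finite set, so one of them,
  \<open>s\<close>, is periodic under doubling. Being noncentral, \<open>s\<close> is conjugate to
  \<open>t\<close>, so \<open>t\<close> is periodic too and hence an iterated double of
  \<open>t + t\<close>, which commutes with \<open>x\<close>.\<close>

lemma (in group_add) noncentral_iterated_doubling:
  fixes x :: 'a
  defines "Z \<equiv> {z. \<forall>x. z + x = x + z}"
  assumes conj: "\<And>x y. x \<notin> Z \<Longrightarrow> y \<notin> Z \<Longrightarrow> \<exists>g. y + g = g + x"
    and dbl: "\<And>x. x \<notin> Z \<Longrightarrow> x + x \<notin> Z"
    and S: "finite S" "t \<in> S" "\<And>y. y \<in> S \<Longrightarrow> y + y \<in> S"
    and t: "t \<notin> Z" "(t + t) + x = x + (t + t)"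
  shows "t + x = x + t"
proof -
  define D where "D k = ((\<lambda>x. x + x) ^^ k)" for k :: nat
  have D_nc: "D k x \<notin> Z" if "x \<notin> Z" for k x
    using that by (induction k) (auto simp: D_def dbl)
  have D_conj: "D k y + g = g + D k x" if "y + g = g + x" for k x y g
    using that by (induction k) (auto simp: D_def conjugate_add)
  have D_S: "D k t \<in> S" for k
    by (induction k) (auto simp: D_def S)
  have "\<not> inj (\<lambda>k. D k t)"
    using finite_subset[of "range (\<lambda>k. D k t)" S] S(1) D_S finite_imageD[of "\<lambda>k. D k t" UNIV] by auto
  then obtain i j where ij: "i < j" "D i t = D j t"
    by (metis injI nat_neq_iff)
  \<comment> \<open>\<open>Suc k\<close> is the positive period; the successor lets a first doubling
    of \<open>t\<close> be split off at the end.\<close>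
  define k where "k = j - i - 1"
  have j: "j = Suc k + i"
    using ij(1) by (simp add: k_def)
  define s where "s = D i t"
  have s: "D (Suc k) s = s"
    using ij(2) unfolding s_def j D_def funpow_add by simp
  obtain g where g: "t + g = g + s"
    using conj[OF _ t(1), of s] D_nc[OF t(1), of i] s_def by blast
  have "D (Suc k) t + g = t + g"
    using D_conj[OF g, of "Suc k"] s g by simp
  then have "D (Suc k) t = t"
    by simp
  moreover have "D k u + x = x + D k u" if "u + x = x + u" for u
    using that by (induction k) (auto simp: D_def, metis add.assoc)
  from this[OF t(2)] have "D (Suc k) t + x = x + D (Suc k) t"
    by (simp only: D_def funpow_Suc_right o_apply)
  ultimately show ?thesis by simp
qed

text \<open>If the group is not commutative, then centralizers of noncentral elements are finite, so
  that the noncentral elements form a single conjugacy class. Either all doubles are central, and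
  then the commutators are central and this conjugacy class is finite; or doubling preserves the
  noncentral elements. In the second case an element \<open>t\<close> which conjugates a noncentral \<open>x\<close> to
  \<open>- x\<close> is a multiple of \<open>t + t\<close>, which commutes with \<open>x\<close>, so that \<open>x + x = 0\<close>.\<close>

lemma minimal_group_rel_commutative:
  fixes R :: "'a::group_add \<Rightarrow> 'a \<Rightarrow> bool"
  assumes min: "minimal_structure group_rel_lang (group_rel_struct R)"
    and fin: "\<And>x::'a. \<exists>S. finite S \<and> x \<in> S \<and> (\<forall>y\<in>S. y + y \<in> S)"
  shows "x + y = y + (x::'a)"
proof (rule ccontr)
  assume neq: "x + y \<noteq> y + x"
  define Z where "Z = {z. \<forall>x. z + x = x + (z::'a)}"
  have ZI: "(\<And>x. z + x = x + z) \<Longrightarrow> z \<in> Z" and ZD: "z \<in> Z \<Longrightarrow> z + x = x + z" for z x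
    by (auto simp: Z_def)
  have inf: "infinite (UNIV :: 'a set)"
    and fin_cofin: "definable_set group_rel_lang (group_rel_struct R) A \<Longrightarrow> finite A \<or> finite (- A)" for A
    using min by (auto simp: minimal_structure_def)
  \<comment> \<open>An infinite centralizer would be cofinite by minimality, but a translate of it
    lies in its complement.\<close>
  have C: "finite {g. g + x = x + g}" if nc: "x \<notin> Z" for x
  proof (rule ccontr)
    let ?C = "{g. g + x = x + g}"
    assume infC: "infinite ?C"
    have "?C = set_of_fm (group_rel_struct R)
        (Eq (Plus (Var 0) (Var 1)) (Plus (Var 1) (Var 0))) (\<lambda>_. x)"
      by (auto simp: set_of_fm_def)
    then have "definable_set group_rel_lang (group_rel_struct R) ?C"
      unfolding definable_set_def by (intro exI conjI) auto
    with fin_cofin infC have "finite (- ?C)" by blast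
    moreover have "\<exists>g. x + g \<noteq> g + x"
      using nc ZI by blast
    then obtain g where g: "g + x \<noteq> x + g" by metis
    have "(+) g ` ?C \<subseteq> - ?C"
    proof -
      have "(g + c) + x \<noteq> x + (g + c)" if "c + x = x + c" for c
      proof
        assume "(g + c) + x = x + (g + c)"
        then have "(g + x) + c = (x + g) + c" by (simp add: add.assoc that)
        with g show False by simp
      qed
      then show ?thesis by blast
    qed
    ultimately have "finite ((+) g ` ?C)"
      using finite_subset by blast
    with infC show False by (simp add: finite_image_iff)
  qed
  define orb where "orb x = {y. \<exists>g. y + g = g + x}" for x :: 'a
  \<comment> \<open>The group is the union, over \<open>y\<close> in the class, of the sets of
    \<open>g\<close> conjugating \<open>x\<close> to \<open>y\<close>; each is contained in a coset
    of the finite centralizer.\<close>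
  have orb: "infinite (orb x)" if "x \<notin> Z" for x
  proof
    assume "finite (orb x)"
    moreover have "finite {g. y + g = g + x}" for y
    proof (cases "\<exists>g. y + g = g + x")
      case True
      then obtain g0 where g0: "y + g0 = g0 + x" by blast
      have "{g. y + g = g + x} \<subseteq> (+) g0 ` {g. g + x = x + g}"
      proof
        fix g assume "g \<in> {g. y + g = g + x}"
        then have g: "y + g = g + x" by simp
        have "g0 + ((- g0 + g) + x) = (y + g0) + (- g0 + g)"
          using g by (simp add: add.assoc)
        also have "\<dots> = g0 + (x + (- g0 + g))"
          using g0 by (simp add: add.assoc)
        finally have "(- g0 + g) + x = x + (- g0 + g)" by simp
        then show "g \<in> (+) g0 ` {g. g + x = x + g}"
          by (intro image_eqI[of _ _ "- g0 + g"]) (auto simp: add.assoc)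
      qed
      then show ?thesis
        using C[OF that] finite_subset by blast
    qed auto
    ultimately have "finite (\<Union>y\<in>orb x. {g. y + g = g + x})" by blast
    moreover have "(\<Union>y\<in>orb x. {g. y + g = g + x}) = UNIV"
    proof -
      have "g + x + - g + g = g + x" for g
        by (simp add: add.assoc del: add_uminus_conv_diff)
      then show ?thesis unfolding orb_def by blast
    qed
    ultimately show False using inf by simp
  qed
  have orb_cofinite: "finite (- orb x)" if "x \<notin> Z" for x
  proof -
    have "orb x = set_of_fm (group_rel_struct R)
        (Exi 2 (Eq (Plus (Var 0) (Var 2)) (Plus (Var 2) (Var 1)))) (\<lambda>_. x)"
      by (auto simp: set_of_fm_def orb_def)
    then have "definable_set group_rel_lang (group_rel_struct R) (orb x)"
      unfolding definable_set_def by (intro exI conjI) auto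
    with orb[OF that] fin_cofin show ?thesis by blast
  qed
  \<comment> \<open>Two cofinite classes in an infinite group meet.\<close>
  have conj: "\<exists>g. y + g = g + x" if "x \<notin> Z" "y \<notin> Z" for x y
  proof -
    have "orb x \<inter> orb y \<noteq> {}"
      using orb_cofinite[OF that(1)] orb_cofinite[OF that(2)] inf
      by (metis Compl_Int finite_UnI Compl_empty_eq)
    then obtain w g k where w: "w + g = g + x" "w + k = k + y"
      unfolding orb_def by blast
    have "k + (y + (- k + g)) = (w + k) + (- k + g)"
      by (simp only: w(2) add.assoc)
    also have "\<dots> = k + ((- k + g) + x)"
      by (simp add: w(1) add.assoc)
    finally have "y + (- k + g) = (- k + g) + x" by (rule add_left_imp_eq)
    then show ?thesis by blast
  qed
  have x: "x \<notin> Z"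
    using neq ZD by blast
  have finZ: "finite Z"
    by (rule finite_subset[OF _ C[OF x]]) (use ZD in blast)
  have add: "u + v \<in> Z" if "u \<in> Z" "v \<in> Z" for u v
  proof (rule ZI)
    have "u + (v + w) = (w + u) + v" for w
      by (simp only: ZD[OF that(2)] ZD[OF that(1), symmetric] add.assoc)
    then show "(u + v) + w = w + (u + v)" for w
      by (simp only: add.assoc)
  qed
  have minus: "- u \<in> Z" if "u \<in> Z" for u
  proof (rule ZI)
    show "- u + v = v + - u" for v
      using ZD[OF that, of "- v"] by (metis add.inverse_inverse minus_add)
  qed
  have ndouble: "\<exists>x. x + x \<notin> Z"
  proof (rule ccontr)
    assume "\<nexists>x. x + x \<notin> Z"
    then have dbl: "u + u \<in> Z" for u by blast
    \<comment> \<open>For a conjugate \<open>y = g + x - g\<close>, centrality of doubles turns the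
      commutator \<open>y - x\<close> into \<open>(g + x) + (g + x) - (x + x) - (g + g)\<close>,
      which is central.\<close>
    have "orb x \<subseteq> (\<lambda>z. z + x) ` Z"
    proof
      fix y assume "y \<in> orb x"
      then obtain g where g: "y + g = g + x" by (auto simp: orb_def)
      define w where "w = (g + x) + (g + x)"
      have y: "y = (g + x) + - g"
        by (simp only: g[symmetric] add.assoc add.right_inverse add.right_neutral)
      have "w + - (x + x) + - (g + g) = w + (- x + (- x + - (g + g)))"
        by (simp only: minus_add add.assoc)
      also have "- x + - (g + g) = - (g + g) + - x"
        using ZD[OF minus[OF dbl[of g]], of "- x"] by simp
      also have "w + (- x + (- (g + g) + - x)) = y + - x"
        by (simp only: w_def y minus_add add.assoc add_minus_cancel)
      finally have "y + - x \<in> Z"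
        unfolding w_def by (metis add minus dbl)
      then show "y \<in> (\<lambda>z. z + x) ` Z"
        by (intro image_eqI[of _ _ "y + - x"]) (simp_all only: add.assoc add.left_inverse add.right_neutral)
    qed
    with orb[OF x] finZ show False
      using finite_subset by blast
  qed
  have conj_Z: "v \<in> Z" if "v + g = g + u" "u \<in> Z" for u v g
    using ZD[OF that(2), of g] that by (metis add_right_cancel)
  \<comment> \<open>All noncentral elements are conjugate, hence so are their doubles, and one
    noncentral double makes all of these noncentral.\<close>
  have dbl: "u + u \<notin> Z" if u: "u \<notin> Z" for u
  proof
    assume "u + u \<in> Z"
    obtain w where w: "w + w \<notin> Z" using ndouble by blast
    then have "w \<notin> Z" using add by blast
    then obtain g where "w + g = g + u" using conj u by blast
    then show False
      using conjugate_add conj_Z \<open>u + u \<in> Z\<close> w by blast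
  qed
  have "- x \<notin> Z"
    using x minus[of "- x"] by auto
  then obtain t where t: "- x + t = t + x"
    using conj[OF x] by blast
  have "(x + t) + x = (t + - x) + x"
    by (simp only: add.assoc t[symmetric] add_minus_cancel add.left_inverse add.right_neutral)
  then have tx: "x + t = t + - x"
    by (rule add_right_imp_eq)
  have xx: "x + x \<in> Z" if "t + x = x + t"
  proof -
    have "- x + t = x + t" using t that by simp
    then have "- x = x" by simp
    then have "x + x = 0" using add.right_inverse[of x] by simp
    then show ?thesis by (auto intro: ZI)
  qed
  have tZ: "t \<notin> Z"
    using xx dbl[OF x] ZD[of t x] by blast
  \<comment> \<open>Conjugation by \<open>t\<close> exchanges \<open>x\<close> and
    \<open>- x\<close>, so conjugating twice fixes \<open>x\<close>.\<close>
  have ttx: "(t + t) + x = x + (t + t)"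
    by (simp only: add.assoc t[symmetric]) (simp only: add.assoc[symmetric] tx)
  from fin[of t] obtain S where S: "finite S" "t \<in> S" and "\<forall>y\<in>S. y + y \<in> S" by blast
  then have SS: "y + y \<in> S" if "y \<in> S" for y using that by blast
  have "t + x = x + t"
    by (rule noncentral_iterated_doubling[of S t x, folded Z_def]) (fact conj dbl S SS tZ ttx)+
  with xx dbl[OF x] show False by blast
qed

section \<open>Orders given by a rank\<close>

abbreviation rank_less :: "('a \<Rightarrow> nat) \<Rightarrow> 'a \<Rightarrow> 'a \<Rightarrow> bool" where
  "rank_less \<sigma> \<equiv> \<lambda>x y. \<sigma> x < \<sigma> y"

section \<open>Quotients of orders that come from a rank\<close>

lemma strict_partial_order_rank: "strict_partial_order (rank_less \<sigma>)"
  by (auto simp: strict_partial_order_def irreflp_def transp_def)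

lemma incomp_rank: "incomp (rank_less \<sigma>) = {(x, y). \<sigma> x = \<sigma> y}"
  by (auto simp: incomparability_def)

lemma equiv_incomp_rank: "equiv UNIV (incomp (rank_less \<sigma>))"
  by (auto simp: incomp_rank equiv_def refl_on_def sym_def trans_def)

lemma incomp_class_rank: "incomp_class (rank_less \<sigma>) x = {y. \<sigma> y = \<sigma> x}"
  by (auto simp: incomp_class_def incomp_rank)

lemma quotient_incomp: "UNIV // incomp lt = range (incomp_class lt)"
  by (auto simp: quotient_def incomp_class_def)

lemma quot_order_rank:
  "quot_order (rank_less \<sigma>) = {(incomp_class (rank_less \<sigma>) x, incomp_class (rank_less \<sigma>) y) | x y. \<sigma> x \<le> \<sigma> y}"
proof -
  let ?c = "incomp_class (rank_less \<sigma>)"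
  have "?c x = ?c y \<or> (\<exists>x' \<in> ?c x. \<exists>y' \<in> ?c y. \<sigma> x' < \<sigma> y') \<longleftrightarrow> \<sigma> x \<le> \<sigma> y" for x y
    by (auto simp: incomp_class_rank set_eq_iff)
  moreover have "quot_order (rank_less \<sigma>) =
      {(?c x, ?c y) | x y. ?c x = ?c y \<or> (\<exists>x' \<in> ?c x. \<exists>y' \<in> ?c y. \<sigma> x' < \<sigma> y')}"
    unfolding quot_order_def quotient_incomp by blast
  ultimately show ?thesis by simp
qed

lemma incomp_class_rank_eq_iff:
  "incomp_class (rank_less \<sigma>) x = incomp_class (rank_less \<sigma>) y \<longleftrightarrow> \<sigma> x = \<sigma> y"
  by (auto simp: incomp_class_rank)

lemma value_order_rank_iff:
  "(incomp_class (rank_less \<sigma>) x, incomp_class (rank_less \<sigma>) y) \<in> value_order (rank_less \<sigma>) \<longleftrightarrow> \<sigma> y \<le> \<sigma> x"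
  by (auto simp: value_order_def quot_order_rank incomp_class_rank_eq_iff)

text \<open>The rank may skip numbers, so the isomorphism with \<open>natLeq\<close> goes through
  the increasing enumeration of its range.\<close>

lemma order_type_omega_rank:
  assumes "infinite (range \<sigma>)"
  shows "order_type_omega (quot_order (rank_less \<sigma>))"
proof -
  define f where "f n = \<sigma> -` {enumerate (range \<sigma>) n}" for n
  have "\<exists>x. \<sigma> x = Infinite_Set.enumerate (range \<sigma>) n" for n
    using enumerate_in_set[OF assms, of n] by (metis imageE)
  then obtain g where g: "\<sigma> (g n) = Infinite_Set.enumerate (range \<sigma>) n" for n by metis
  have f: "f n = incomp_class (rank_less \<sigma>) (g n)" for n
    by (auto simp: f_def incomp_class_rank g)
  have class_f: "\<exists>n. incomp_class (rank_less \<sigma>) x = f n \<and> \<sigma> x = Infinite_Set.enumerate (range \<sigma>) n" for x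
    using enumerate_Ex[OF assms, of "\<sigma> x"] by (auto simp: f incomp_class_rank_eq_iff g eq_commute[of "\<sigma> x"])
  have "inj f"
    by (rule injI) (use strict_mono_enumerate[OF assms] in
      \<open>auto simp: f incomp_class_rank_eq_iff g strict_mono_eq\<close>)
  then have "natLeq =o dir_image natLeq f"
    by (intro dir_image_ordIso natLeq_Well_order) (auto intro: inj_on_subset)
  moreover have "dir_image natLeq f = quot_order (rank_less \<sigma>)"
  proof (intro set_eqI iffI)
    fix p assume "p \<in> dir_image natLeq f"
    then obtain m n where mn: "m \<le> n" "p = (f m, f n)"
      by (auto simp: dir_image_def natLeq_def)
    moreover have "\<sigma> (g m) \<le> \<sigma> (g n)"
      using strict_mono_enumerate[OF assms] mn(1) by (simp add: g strict_mono_less_eq)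
    ultimately show "p \<in> quot_order (rank_less \<sigma>)"
      unfolding quot_order_rank f by blast
  next
    fix p assume "p \<in> quot_order (rank_less \<sigma>)"
    then obtain x y where xy: "\<sigma> x \<le> \<sigma> y"
        "p = (incomp_class (rank_less \<sigma>) x, incomp_class (rank_less \<sigma>) y)"
      unfolding quot_order_rank by blast
    obtain m n where "incomp_class (rank_less \<sigma>) x = f m" "\<sigma> x = Infinite_Set.enumerate (range \<sigma>) m"
        "incomp_class (rank_less \<sigma>) y = f n" "\<sigma> y = Infinite_Set.enumerate (range \<sigma>) n"
      using class_f by meson
    with xy strict_mono_enumerate[OF assms] show "p \<in> dir_image natLeq f"
      by (auto simp: dir_image_def natLeq_def strict_mono_less_eq)
  qed
  ultimately show ?thesis
    unfolding order_type_omega_def using ordIso_symmetric by metis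
qed

text \<open>The rank of an element is the position of its class in the order type. It reflects
  \<open>lt\<close> because incomparable elements share a class and \<open>lt\<close> is
  asymmetric.\<close>

lemma order_type_omega_obtains_rank:
  assumes "strict_partial_order lt" "equiv UNIV (incomp lt)" "order_type_omega (quot_order lt)"
  obtains \<rho> where "surj \<rho>" "lt = rank_less \<rho>"
proof -
  let ?c = "incomp_class lt"
  have asym: "\<not> lt y x" if "lt x y" for x y
    using assms(1) that by (auto simp: strict_partial_order_def irreflp_def dest: transpD)
  have c_eq: "?c x = ?c y \<longleftrightarrow> \<not> lt x y \<and> \<not> lt y x" for x y
    using eq_equiv_class_iff[OF assms(2), of x y] by (simp add: incomp_class_def incomparability_def)
  have c_mem: "x \<in> ?c y \<longleftrightarrow> ?c x = ?c y" for x y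
    using c_eq[of x y] by (auto simp: incomp_class_def incomparability_def)
  have quot: "(?c x, ?c y) \<in> quot_order lt \<longleftrightarrow> ?c x = ?c y \<or> (\<exists>x'\<in>?c x. \<exists>y'\<in>?c y. lt x' y')" for x y
    by (auto simp: quot_order_def quotient_incomp)
  have field: "Field (quot_order lt) = range ?c"
    by (auto simp: quot_order_def quotient_incomp Field_def)
  obtain f where "iso (quot_order lt) natLeq f"
    using assms(3) by (auto simp: order_type_omega_def ordIso_def)
  then have bij: "bij_betw f (range ?c) UNIV"
    and f: "(?c x, ?c y) \<in> quot_order lt \<longleftrightarrow> f (?c x) \<le> f (?c y)" for x y
    unfolding iso_iff2 field Field_natLeq by (auto simp: natLeq_def)
  define \<rho> where "\<rho> x = f (?c x)" for x
  have rho_eq: "\<rho> x = \<rho> y \<longleftrightarrow> ?c x = ?c y" for x y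
    using bij by (auto simp: \<rho>_def bij_betw_def inj_on_def)
  have less: "\<rho> x < \<rho> y" if "lt x y" for x y
  proof -
    have "(?c x, ?c y) \<in> quot_order lt"
      using that unfolding quot by (auto simp: c_mem)
    then have "\<rho> x \<le> \<rho> y" by (simp add: f \<rho>_def)
    moreover have "\<rho> x \<noteq> \<rho> y"
      using that by (simp add: rho_eq c_eq)
    ultimately show ?thesis by simp
  qed
  have "lt x y" if "\<rho> x < \<rho> y" for x y
    using that less[of y x] rho_eq[of x y] c_eq[of x y] by auto
  with less have "lt = rank_less \<rho>" by (auto simp: fun_eq_iff)
  moreover have "surj \<rho>"
  proof -
    have "range \<rho> = f ` range ?c" by (auto simp: \<rho>_def)
    then show ?thesis using bij by (simp add: bij_betw_def)
  qed
  ultimately show thesis using that by blast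
qed

text \<open>The value order reverses ranks: the ultrametric inequality becomes a bound by the
  maximum, and the top value is the class of rank 0.\<close>

lemma valued_abelian_group_rank:
  fixes \<sigma> :: "'a::group_add \<Rightarrow> nat"
  assumes comm: "\<And>x y :: 'a. x + y = y + x"
    and zero: "\<And>x. \<sigma> x = 0 \<longleftrightarrow> x = 0"
    and diff: "\<And>x y. \<sigma> (x - y) \<le> max (\<sigma> x) (\<sigma> y)"
  shows "valued_abelian_group (incomp_class (rank_less \<sigma>)) (UNIV // incomp (rank_less \<sigma>))
    (value_order (rank_less \<sigma>))"
proof -
  let ?c = "incomp_class (rank_less \<sigma>)" and ?r = "value_order (rank_less \<sigma>)"
  have sub: "?r \<subseteq> range ?c \<times> range ?c"
    by (auto simp: value_order_def quot_order_rank)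
  have "linear_order_on (range ?c) ?r"
    unfolding order_on_defs
  proof (intro conjI)
    show "?r \<subseteq> range ?c \<times> range ?c" by (fact sub)
    show "refl_on (range ?c) ?r"
      by (auto simp: refl_on_def value_order_rank_iff)
    show "antisym ?r"
    proof (rule antisymI)
      fix X Y assume *: "(X, Y) \<in> ?r" "(Y, X) \<in> ?r"
      then obtain x y where "X = ?c x" "Y = ?c y" using sub by blast
      with * show "X = Y" by (simp add: value_order_rank_iff incomp_class_rank_eq_iff)
    qed
    show "trans ?r"
    proof (rule transI)
      fix X Y W assume *: "(X, Y) \<in> ?r" "(Y, W) \<in> ?r"
      then obtain x y w where "X = ?c x" "Y = ?c y" "W = ?c w" using sub by blast
      with * show "(X, W) \<in> ?r" by (simp add: value_order_rank_iff)
    qed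
    show "total_on (range ?c) ?r"
      by (auto simp: total_on_def value_order_rank_iff)
  qed
  moreover have "\<exists>top\<in>range ?c. (\<forall>\<gamma>\<in>range ?c. (\<gamma>, top) \<in> ?r) \<and> (\<forall>x. ?c x = top \<longleftrightarrow> x = 0)"
  proof (intro bexI[of _ "?c 0"] conjI ballI allI)
    have zero': "\<sigma> 0 = 0" by (simp add: zero)
    show "(\<gamma>, ?c 0) \<in> ?r" if "\<gamma> \<in> range ?c" for \<gamma>
      using that by (auto simp: value_order_rank_iff zero')
    show "?c x = ?c 0 \<longleftrightarrow> x = 0" for x
      by (simp add: incomp_class_rank_eq_iff zero' zero)
  qed simp
  moreover have "(min_wrt ?r (?c x) (?c y), ?c (x - y)) \<in> ?r" for x y
    using diff[of x y] by (auto simp: min_wrt_def value_order_rank_iff)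
  ultimately show ?thesis
    unfolding valued_abelian_group_def quotient_incomp using comm by blast
qed

text \<open>\<open>\<sigma> x < \<sigma> y\<close> is the negation of
  \<open>\<sigma> y \<le> \<sigma> x\<close>, so the same formula works in both directions.\<close>

lemma interdefinable_rank:
  "interdefinable (rank_less \<sigma>) (incomp_class (rank_less \<sigma>)) (value_order (rank_less \<sigma>))"
proof -
  let ?\<phi> = "Neg (Less (Var 0) (Var 1))"
  have "wf_fm group_rel_lang ?\<phi>" by simp
  moreover have "valuation_rel (incomp_class (rank_less \<sigma>)) (value_order (rank_less \<sigma>)) = (\<lambda>x y. \<sigma> y \<le> \<sigma> x)"
    by (auto simp: valuation_rel_def value_order_rank_iff fun_eq_iff)
  moreover have "rank_less \<sigma> = rel_of_fm (group_rel_struct (\<lambda>x y. \<sigma> y \<le> \<sigma> x)) ?\<phi> e"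
      "(\<lambda>x y. \<sigma> y \<le> \<sigma> x) = rel_of_fm (group_rel_struct (rank_less \<sigma>)) ?\<phi> e" for e
    by (auto simp: rel_of_fm_def fun_eq_iff)
  ultimately show ?thesis
    unfolding interdefinable_def definable_rel_def by metis
qed

text \<open>An element of least \<open>\<rho>\<close> among those with large \<open>\<sigma>\<close> is a record.\<close>

lemma infinite_records:
  fixes \<rho> \<sigma> :: "'a \<Rightarrow> nat"
  assumes "infinite (UNIV :: 'a set)" and "\<And>n. finite {x. \<sigma> x \<le> n}"
  shows "infinite {a. \<forall>b. \<rho> b < \<rho> a \<longrightarrow> \<sigma> b < \<sigma> a}" (is "infinite ?A")
proof
  assume "finite ?A"
  then obtain n where n: "\<forall>k \<in> \<sigma> ` ?A. k \<le> n"
    using finite_nat_set_iff_bounded_le[of "\<sigma> ` ?A"] by blast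
  have "{x. \<sigma> x \<le> n} \<noteq> UNIV" using assms by metis
  then obtain c where "\<not> \<sigma> c \<le> n" by blast
  then have "n < \<sigma> c" by simp
  then obtain a where a: "n < \<sigma> a" "\<And>b. n < \<sigma> b \<Longrightarrow> \<rho> a \<le> \<rho> b"
    using ex_has_least_nat[of "\<lambda>x. n < \<sigma> x" c \<rho>] by blast
  have "\<sigma> b < \<sigma> a" if "\<rho> b < \<rho> a" for b
  proof -
    have "\<not> n < \<sigma> b" using a(2)[of b] that by auto
    with a(1) show ?thesis by simp
  qed
  then have "\<sigma> a \<le> n" using n by blast
  with a(1) show False by simp
qed

section \<open>The valuation\<close>

locale ranked_minimal_group =
  fixes \<rho> :: "'a::group_add \<Rightarrow> nat"
  assumes surj_rank: "surj \<rho>"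
    and minimal: "minimal_structure group_rel_lang (group_rel_struct (rank_less \<rho>))"
begin

abbreviation "M \<equiv> group_rel_struct (rank_less \<rho>)"

text \<open>Makes 0 definable although the language has no constant for it.\<close>

lemma add_self_eq_self_iff: "x + x = x \<longleftrightarrow> x = (0 :: 'a)"
  using add_left_cancel[of x x 0] by simp

lemma infinite_carrier: "infinite (UNIV :: 'a set)"
  using minimal by (simp add: minimal_structure_def)

lemma finite_or_cofinite:
  assumes "wf_fm group_rel_lang \<phi>" and "\<And>x. x \<in> A \<longleftrightarrow> sat M (e(0 := x)) \<phi>"
  shows "finite A \<or> finite (- A)"
proof -
  have "A = set_of_fm M \<phi> e" using assms(2) by (auto simp: set_of_fm_def)
  with assms(1) minimal show ?thesis
    unfolding minimal_structure_def definable_set_def by blast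
qed

section \<open>Translations preserve almost all ranks\<close>

lemma finite_rank_le: "finite {x. \<rho> x \<le> n}"
proof -
  \<comment> \<open>Comparison with the parameter \<open>z\<close> makes the segment definable; it
    is not cofinite, as all ranks above \<open>n\<close> occur outside it.\<close>
  obtain z where z: "\<rho> z = Suc n" using surj_rank by (metis surjD)
  let ?A = "{x. \<rho> x \<le> n}"
  have "finite ?A \<or> finite (- ?A)"
    by (rule finite_or_cofinite[of "Less (Var 0) (Var 1)" _ "\<lambda>_. z"]) (auto simp: z)
  moreover have "{n<..} \<subseteq> \<rho> ` (- ?A)"
  proof
    fix k assume k: "k \<in> {n<..}"
    obtain x where "\<rho> x = k" using surj_rank by (metis surjD)
    with k show "k \<in> \<rho> ` (- ?A)" by (intro image_eqI[of _ _ x]) auto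
  qed
  then have "infinite (\<rho> ` (- ?A))"
    using infinite_Ioi infinite_super by blast
  then have "infinite (- ?A)"
    using finite_imageI by blast
  ultimately show ?thesis by blast
qed

text \<open>If \<open>x + a\<close> had larger rank than \<open>x\<close> for cofinitely many \<open>x\<close>, then the sets
  \<open>{x. \<rho> x \<le> n}\<close> with \<open>n\<close> large would be closed under \<open>\<lambda>x. x - a\<close>, hence, being finite, also
  under \<open>\<lambda>x. x + a\<close>.\<close>

lemma finite_rank_less_shift: "finite {x. \<rho> x < \<rho> (x + a)}"
proof (rule ccontr)
  let ?U = "{x. \<rho> x < \<rho> (x + a)}"
  assume "infinite ?U"
  moreover have "finite ?U \<or> finite (- ?U)"
    by (rule finite_or_cofinite[of "Less (Var 0) (Plus (Var 0) (Var 1))" _ "\<lambda>_. a"]) auto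
  ultimately have "finite (\<rho> ` (- ?U))" by blast
  then obtain n where n: "\<forall>k\<in>\<rho> ` (- ?U). k \<le> n"
    using finite_nat_set_iff_bounded_le by blast
  \<comment> \<open>\<open>x\<close> has the largest rank in \<open>S\<close> and lies in
    \<open>?U\<close>, so \<open>x + a\<close> would have to leave \<open>S\<close>.\<close>
  obtain x where x: "\<rho> x = Suc n" using surj_rank by (metis surjD)
  define S where "S = {y. \<rho> y \<le> Suc n}"
  have "\<rho> (y - a) \<le> Suc n" if "\<rho> y \<le> Suc n" for y
  proof (cases "y - a \<in> ?U")
    case True
    with that show ?thesis by simp
  next
    case False
    then have "\<rho> (y - a) \<le> n" using n by blast
    then show ?thesis by simp
  qed
  then have "(\<lambda>y. y - a) ` S \<subseteq> S" by (auto simp: S_def)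
  moreover have "inj_on (\<lambda>y. y - a) S" by (auto intro: inj_onI)
  moreover have "finite S" unfolding S_def by (rule finite_rank_le)
  ultimately have "(\<lambda>y. y - a) ` S = S"
    by (meson endo_inj_surj)
  moreover have "x \<in> S" by (simp add: S_def x)
  ultimately obtain y where y: "y \<in> S" "x = y - a" by blast
  then have "x + a = y" by simp
  with y(1) have "\<rho> (x + a) \<le> \<rho> x" by (simp add: S_def x)
  then have "x \<notin> ?U" by simp
  then have "\<rho> x \<le> n" using n by blast
  with x show False by simp
qed

lemma finite_rank_neq_shift: "finite {x. \<rho> (x + a) \<noteq> \<rho> x}"
proof -
  \<comment> \<open>A fall in rank from \<open>x\<close> to \<open>x + a\<close> is a rise under
    translation of \<open>x + a\<close> by \<open>- a\<close>.\<close>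
  have "{x. \<rho> (x + a) < \<rho> x} \<subseteq> (\<lambda>x. x - a) ` {x. \<rho> x < \<rho> (x + - a)}"
    by (auto intro!: image_eqI[of _ _ "_ + a"])
  then have "finite {x. \<rho> (x + a) < \<rho> x}"
    using finite_subset finite_rank_less_shift by blast
  moreover have "{x. \<rho> (x + a) \<noteq> \<rho> x} = {x. \<rho> x < \<rho> (x + a)} \<union> {x. \<rho> (x + a) < \<rho> x}"
    by auto
  ultimately show ?thesis
    using finite_rank_less_shift by simp
qed

section \<open>The balls and their valuation\<close>

definition stab :: "nat \<Rightarrow> 'a set" where
  "stab n = {a. \<forall>x. n < \<rho> x \<longrightarrow> \<rho> (x + a) = \<rho> x}"

lemma stab_mono: "m \<le> n \<Longrightarrow> stab m \<subseteq> stab n"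
  by (auto simp: stab_def)

lemma zero_stab: "0 \<in> stab n"
  by (simp add: stab_def)

lemma ex_stab: "\<exists>n. a \<in> stab n"
proof -
  have "finite (\<rho> ` {x. \<rho> (x + a) \<noteq> \<rho> x})"
    by (intro finite_imageI finite_rank_neq_shift)
  then obtain n where "\<forall>k \<in> \<rho> ` {x. \<rho> (x + a) \<noteq> \<rho> x}. k \<le> n"
    using finite_nat_set_iff_bounded_le by blast
  then have "a \<in> stab n" by (fastforce simp: stab_def)
  then show ?thesis by blast
qed

lemma finite_stab: "finite (stab n)"
proof -
  \<comment> \<open>Adding elements of \<open>stab n\<close> to \<open>x\<close> is injective and
    keeps the rank at \<open>Suc n\<close>.\<close>
  obtain x where x: "\<rho> x = Suc n" using surj_rank by (metis surjD)
  have "(+) x ` stab n \<subseteq> {y. \<rho> y \<le> Suc n}"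
    using x by (auto simp: stab_def)
  then have "finite ((+) x ` stab n)"
    using finite_rank_le finite_subset by blast
  then show ?thesis by (simp add: finite_image_iff)
qed

text \<open>The first translation leaves the rank above \<open>n\<close>, so the second one
  preserves it again.\<close>

lemma stab_add: "a \<in> stab n \<Longrightarrow> b \<in> stab n \<Longrightarrow> a + b \<in> stab n"
  by (simp add: stab_def flip: add.assoc)

text \<open>Finiteness of \<open>stab n\<close> turns closure under addition into closure under negation.\<close>

lemma stab_uminus:
  assumes "a \<in> stab n"
  shows "- a \<in> stab n"
proof -
  have "(+) a ` stab n \<subseteq> stab n" using assms stab_add by blast
  then have "(+) a ` stab n = stab n"
    by (rule endo_inj_surj[OF finite_stab]) (auto intro: inj_onI)
  then obtain b where "b \<in> stab n" "a + b = 0"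
    using zero_stab[of n] by (metis imageE)
  then show ?thesis by (metis minus_unique)
qed

text \<open>The successor reserves 0 for the zero element, making \<open>{0}\<close> the smallest
  ball even if \<open>stab 0\<close> is larger.\<close>

definition val :: "'a \<Rightarrow> nat" where
  "val a = (if a = 0 then 0 else Suc (LEAST n. a \<in> stab n))"

lemma val_eq_0_iff: "val a = 0 \<longleftrightarrow> a = 0"
  by (simp add: val_def)

lemma val_le_Suc_iff: "val a \<le> Suc n \<longleftrightarrow> a \<in> stab n"
proof (cases "a = 0")
  case True
  then show ?thesis by (simp add: val_def zero_stab)
next
  case False
  have "(LEAST n. a \<in> stab n) \<le> n \<longleftrightarrow> a \<in> stab n"
    using LeastI_ex[OF ex_stab[of a]] stab_mono Least_le[of "\<lambda>n. a \<in> stab n" n] by blast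
  with False show ?thesis by (simp add: val_def)
qed

lemma val_diff: "val (x - y) \<le> max (val x) (val y)"
proof (cases "max (val x) (val y)")
  case 0
  then have "x = 0" "y = 0" by (simp_all add: max_def val_eq_0_iff split: if_splits)
  then show ?thesis by (simp add: val_def)
next
  case (Suc n)
  then have "val x \<le> Suc n" "val y \<le> Suc n" by linarith+
  then have "x + - y \<in> stab n"
    by (intro stab_add stab_uminus) (simp_all add: val_le_Suc_iff)
  then show ?thesis by (simp add: Suc val_le_Suc_iff)
qed

lemma finite_val_le: "finite {x. val x \<le> n}"
  by (rule finite_subset[OF _ finite_stab[of n]]) (auto simp flip: val_le_Suc_iff)

lemma infinite_range_val: "infinite (range val)"
proof
  assume "finite (range val)"
  then obtain n where "\<forall>k\<in>range val. k \<le> n"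
    using finite_nat_set_iff_bounded_le by blast
  then have "{x. val x \<le> n} = UNIV" by auto
  with finite_val_le[of n] infinite_carrier show False by simp
qed

text \<open>Writing the index as \<open>\<rho> y\<close> turns a quantifier over numbers into one
  over the group, hence into first-order form. The first disjunct covers values 0 and 1, which no
  \<open>stab n\<close> separates.\<close>

lemma val_less_iff:
  "val a < val b \<longleftrightarrow> (a = 0 \<and> b \<noteq> 0) \<or> (\<exists>y. a \<in> stab (\<rho> y) \<and> b \<notin> stab (\<rho> y))"
proof -
  have "(\<exists>y. a \<in> stab (\<rho> y) \<and> b \<notin> stab (\<rho> y)) \<longleftrightarrow> (\<exists>n. a \<in> stab n \<and> b \<notin> stab n)"
    using surj_rank by (metis surjD)
  also have "\<dots> \<longleftrightarrow> val a < val b \<and> (a = 0 \<longrightarrow> \<not> val b \<le> 1)"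
  proof
    assume "\<exists>n. a \<in> stab n \<and> b \<notin> stab n"
    then show "val a < val b \<and> (a = 0 \<longrightarrow> \<not> val b \<le> 1)"
      by (auto simp flip: val_le_Suc_iff)
  next
    assume "val a < val b \<and> (a = 0 \<longrightarrow> \<not> val b \<le> 1)"
    \<comment> \<open>The index is \<open>val a - 1\<close>, truncated to 0 for
      \<open>a = 0\<close>; the side condition then excludes \<open>val b = 1\<close>.\<close>
    then have "val a \<le> Suc (val a - 1)" "\<not> val b \<le> Suc (val a - 1)"
      using val_eq_0_iff[of a] by (cases "val a"; auto)+
    then show "\<exists>n. a \<in> stab n \<and> b \<notin> stab n"
      unfolding val_le_Suc_iff by blast
  qed
  finally show ?thesis
    using val_eq_0_iff[of a] val_eq_0_iff[of b] by auto
qed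

text \<open>The rank of the value of \<open>Var j\<close> serves as the index, and equality of ranks
  is written as incomparability. Variables 8 and 9 are reserved for quantifiers.\<close>

definition stab_fm :: "nat \<Rightarrow> nat \<Rightarrow> (unit, unit) fm" where
  "stab_fm i j = All 9 (Imp (Less (Var j) (Var 9))
     (Conj (Neg (Less (Var 9) (Plus (Var 9) (Var i)))) (Neg (Less (Plus (Var 9) (Var i)) (Var 9)))))"

definition val_less_fm :: "nat \<Rightarrow> nat \<Rightarrow> (unit, unit) fm" where
  "val_less_fm i j =
     Neg (Conj (Neg (Conj (Eq (Plus (Var i) (Var i)) (Var i)) (Neg (Eq (Plus (Var j) (Var j)) (Var j)))))
       (Neg (Exi 8 (Conj (stab_fm i 8) (Neg (stab_fm j 8))))))"

lemma wf_val_less_fm [simp]: "wf_fm group_rel_lang (val_less_fm i j)"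
  by (simp add: val_less_fm_def stab_fm_def)

lemma sat_stab_fm: "i \<noteq> 9 \<Longrightarrow> j \<noteq> 9 \<Longrightarrow> sat M e (stab_fm i j) \<longleftrightarrow> e i \<in> stab (\<rho> (e j))"
  by (auto simp: stab_fm_def stab_def)

lemma sat_val_less_fm [simp]:
  "i \<notin> {8, 9} \<Longrightarrow> j \<notin> {8, 9} \<Longrightarrow> sat M e (val_less_fm i j) \<longleftrightarrow> val (e i) < val (e j)"
  by (auto simp: val_less_fm_def sat_stab_fm val_less_iff add_self_eq_self_iff)

lemma definable_val_less: "definable_rel group_rel_lang M (rank_less val)"
proof -
  have "rank_less val = rel_of_fm M (val_less_fm 0 1) e" for e
    by (auto simp: rel_of_fm_def fun_eq_iff)
  then show ?thesis
    unfolding definable_rel_def using wf_val_less_fm by metis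
qed

lemma finite_val_less_neq_rank_less:
  "finite {a. \<exists>b. \<not> (val b < val a \<longleftrightarrow> \<rho> b < \<rho> a)}"
proof -
  let ?A = "{a. \<forall>b. \<rho> b < \<rho> a \<longrightarrow> val b < val a}" and ?B = "{a. \<forall>b. val b < val a \<longrightarrow> \<rho> b < \<rho> a}"
  have "finite ?A \<or> finite (- ?A)"
    by (rule finite_or_cofinite[of "All 1 (Imp (Less (Var 1) (Var 0)) (val_less_fm 1 0))"]) auto
  moreover have "finite ?B \<or> finite (- ?B)"
    by (rule finite_or_cofinite[of "All 1 (Imp (val_less_fm 1 0) (Less (Var 1) (Var 0)))"]) auto
  \<comment> \<open>\<open>infinite_records\<close> applies with \<open>\<rho>\<close> and
    \<open>val\<close> in either role, since both have finite initial segments.\<close>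
  moreover have "infinite ?A" "infinite ?B"
    using infinite_records infinite_carrier finite_val_le finite_rank_le by blast+
  ultimately have "finite (- ?A \<union> - ?B)" by blast
  then show ?thesis
    by (rule finite_subset[rotated]) auto
qed

lemma commutative: "x + y = y + (x :: 'a)"
proof (rule minimal_group_rel_commutative[OF minimal])
  fix x :: 'a
  obtain n where "x \<in> stab n" using ex_stab by blast
  then show "\<exists>S. finite S \<and> x \<in> S \<and> (\<forall>y\<in>S. y + y \<in> S)"
    by (intro exI[of _ "stab n"]) (simp add: finite_stab stab_add)
qed

end

theorem proposition4p1:
  fixes L :: "('f, 'r) lang"
    and G :: "('f, 'r, 'a::group_add) struct"
    and pl :: 'f
    and Gbar :: "('f, 'r, 'b) struct"
    and h :: "'a \<Rightarrow> 'b"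
    and lt :: "'a \<Rightarrow> 'a \<Rightarrow> bool"
  assumes "minimal_group L G pl"
    and "monster_model L G Gbar h"
    and "almost_linear L G Gbar h"
    and "definable_rel L G lt"
    and "strict_partial_order lt"
    and "equiv UNIV (incomp lt)"
    and "order_type_omega (quot_order lt)"
  shows "\<exists>lt'. finite_modification L G lt lt' \<and>
           equiv UNIV (incomp lt') \<and>
           valued_abelian_group (incomp_class lt') (UNIV // incomp lt') (value_order lt') \<and>
           order_type_omega_star (value_order lt') \<and>
           interdefinable lt' (incomp_class lt') (value_order lt')"
proof -
  obtain \<rho> where \<rho>: "surj \<rho>" "lt = rank_less \<rho>"
    using order_type_omega_obtains_rank[OF assms(5-7)] .
  have pl: "fun_ar L pl = Some 2" "\<forall>x y. fun_int G pl [x, y] = x + y"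
    using assms(1) by (simp_all add: minimal_group_def)
  interpret ranked_minimal_group \<rho>
    by unfold_locales (use \<rho> minimal_structure_reduct[OF assms(1,4)] in simp_all)
  let ?lt = "rank_less val"
  have "definable_rel L G ?lt"
    using definable_rel_reduct[OF assms(4) pl] definable_val_less \<rho>(2) by simp
  \<comment> \<open>The two orders agree as soon as the second argument lies outside the finite
    exceptional set.\<close>
  then have "finite_modification L G lt ?lt"
    unfolding finite_modification_def \<rho>(2)
    by (intro conjI strict_partial_order_rank exI[of _ "{a. \<exists>b. \<not> (val b < val a \<longleftrightarrow> \<rho> b < \<rho> a)}"])
      (use finite_val_less_neq_rank_less in auto)
  moreover have "valued_abelian_group (incomp_class ?lt) (UNIV // incomp ?lt) (value_order ?lt)"
    by (intro valued_abelian_group_rank commutative val_eq_0_iff val_diff)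
  moreover have "order_type_omega_star (value_order ?lt)"
    using order_type_omega_rank[OF infinite_range_val]
    by (simp add: order_type_omega_star_def value_order_def)
  ultimately show ?thesis
    using equiv_incomp_rank interdefinable_rank by (intro exI[of _ ?lt] conjI)
qed

end
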